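(* Consider the stochastic six-vertex model with parameters $b$ and $q$ in the quadrant with arbitrary (possibly, even random) boundary conditions, and let $H$ be its height function. For each pair of integers $x,y\ge0$ we have an identity $$q^{H(x+1,y+1)}-b\, q^{H(x,y+1)}-bq\, q^{H(x+1,y)}+(b+bq-1)\,q^{H(x,y)}=\xi(x+1,y+1),$$ where the conditional expectation and variance of $\xi$ are $$\mathbb E\bigl[\xi(x+1,y+1)\mid H(u,v),\ u\le x\text{ or }v\le y\bigr]=0,$$ $$\mathbb E\bigl[\xi^2(x+1,y+1)\mid H(u,v),\ u\le x\text{ or }v\le y\bigr]=\bigl(qb(1-b)+b(1-qb)\bigr)\Delta_x\Delta_y+b(1-qb)(1-q)q^{H(x,y)}\Delta_x-b(1-b)(1-q)q^{H(x,y)}\Delta_y,$$ with $$\Delta_x=q^{H(x+1,y)}-q^{H(x,y)},\qquad \Delta_y=q^{H(x,y+1)}-q^{H(x,y)}.$$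
   Context: **Stochastic six-vertex model.** Parameters $0<b<1$, $q>0$ with $bq<1$. Vertices are the points of $\mathbb Z_{\ge1}^2$. A boundary condition specifies for which $j\ge1$ a path enters the vertex $(1,j)$ from the left and for which $i\ge1$ a path enters the vertex $(i,1)$ from below. Given the boundary condition, the configuration of up-right paths is built sequentially from the bottom-left corner in the up-right direction; at each vertex, given the incoming paths, the outgoing paths are sampled independently of everything else: * no incoming paths: no outgoing paths; * two incoming paths (from the left and from below): two outgoing paths (right and up); * one incoming path, from the left: it exits right with probability $b$ and up with probability $1-b$; * one incoming path, from below: it exits up with probability $bq$ and right with probability $1-bq$. **Height function.** $H(x,y)$, $(x,y)\in\mathbb Z_{\ge0}^2$, is attached to the face of the square grid with center $(x+\frac12,y+\frac12)$. It satisfies $H(0,0)=0$; $H(x,y)-H(x,y-1)$ equals $1$ if a path occupies the horizontal edge joining $(x,y)$ to $(x+1,y)$ (for $x=0$: if a path enters $(1,y)$ from the left) and $0$ otherwise; $H(x,y)-H(x-1,y)$ equals $-1$ if a path occupies the vertical edge joining $(x,y)$ to $(x,y+1)$ (for $y=0$: if a path enters $(x,1)$ from below) and $0$ otherwise. *)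

theory Defs
  imports "HOL-Probability.Probability"
begin

text \<open>
  Vertices are the points \<open>(x, y)\<close> with \<open>x, y \<ge> 1\<close>. \<open>Hor x y\<close> (with \<open>y \<ge> 1\<close>) is the edge from \<open>(x, y)\<close>
  to \<open>(x + 1, y)\<close>, and \<open>Ver x y\<close> (with \<open>x \<ge> 1\<close>) the edge from \<open>(x, y)\<close> to \<open>(x, y + 1)\<close>; \<open>Hor 0 y\<close> and
  \<open>Ver x 0\<close> are the edges through which paths enter the quadrant. Nothing below refers to the
  spurious edges \<open>Hor x 0\<close> and \<open>Ver 0 y\<close>.
\<close>

datatype edge = Hor nat nat | Ver nat nat

type_synonym config = "edge \<Rightarrow> bool"

definition vertices :: "(nat \<times> nat) set" where
  "vertices = {1..} \<times> {1..}"

definition boundary_edges :: "edge set" where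
  "boundary_edges = {Hor 0 y | y. 1 \<le> y} \<union> {Ver x 0 | x. 1 \<le> x}"

definition out_edges :: "(nat \<times> nat) set \<Rightarrow> edge set" where
  "out_edges S = (\<lambda>(x, y). Hor x y) ` S \<union> (\<lambda>(x, y). Ver x y) ` S"

definition quadrant_edges :: "edge set" where
  "quadrant_edges = boundary_edges \<union> out_edges vertices"

definition path_conservation :: "config \<Rightarrow> bool" where
  "path_conservation \<eta> \<longleftrightarrow> (\<forall>x\<ge>1. \<forall>y\<ge>1.
     of_bool (\<eta> (Hor (x - 1) y)) + of_bool (\<eta> (Ver x (y - 1)))
       = (of_bool (\<eta> (Hor x y)) + of_bool (\<eta> (Ver x y)) :: nat))"

text \<open>Distribution of the outgoing pair (right, up) given the incoming pair (from the left, from below).\<close>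

definition vertex_pmf :: "real \<Rightarrow> real \<Rightarrow> bool \<times> bool \<Rightarrow> (bool \<times> bool) pmf" where
  "vertex_pmf b q i = (case i of
      (False, False) \<Rightarrow> return_pmf (False, False)
    | (True, True) \<Rightarrow> return_pmf (True, True)
    | (True, False) \<Rightarrow> map_pmf (\<lambda>straight. (straight, \<not> straight)) (bernoulli_pmf b)
    | (False, True) \<Rightarrow> map_pmf (\<lambda>straight. (\<not> straight, straight)) (bernoulli_pmf (b * q)))"

definition down_closed :: "(nat \<times> nat) set \<Rightarrow> bool" where
  "down_closed S \<longleftrightarrow> S \<subseteq> vertices \<and>
     (\<forall>(x, y)\<in>S. \<forall>x' y'. 1 \<le> x' \<longrightarrow> x' \<le> x \<longrightarrow> 1 \<le> y' \<longrightarrow> y' \<le> y \<longrightarrow> (x', y') \<in> S)"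

text \<open>
  The \<open>\<sigma>\<close>-algebra generated by the variables \<open>X i\<close>, \<open>i \<in> I\<close>. It uses all preimages, so it is
  meant for variables with values in a countable discrete space.
\<close>

definition generated_by :: "'w measure \<Rightarrow> 'i set \<Rightarrow> ('i \<Rightarrow> 'w \<Rightarrow> 'c::countable) \<Rightarrow> 'w measure" where
  "generated_by M I X = sigma (space M) {X i -` A \<inter> space M | i A. i \<in> I}"

lemma subalgebra_generated_by:
  assumes "\<And>i. i \<in> I \<Longrightarrow> X i \<in> measurable M (count_space UNIV)"
  shows "subalgebra M (generated_by M I X)"
proof -
  have "{X i -` A \<inter> space M | i A. i \<in> I} \<subseteq> sets M"
    using assms by (auto intro: measurable_sets)
  then show ?thesis
    unfolding subalgebra_def generated_by_def
    by (auto simp: space_measure_of_conv sets.sigma_sets_subset sets_measure_of_conv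
        split: if_splits)
qed

text \<open>
  A random configuration of paths \<open>\<eta>\<close> on the probability space \<open>M\<close>. The boundary values are
  arbitrary random variables. The clause \<open>sampling\<close> is the sequential construction: once the
  boundary condition and the outgoing edges at the vertices of a finite down-closed set \<open>S\<close> are
  known, the outgoing edges at any vertex \<open>(x, y)\<close> that may come next are sampled from
  \<open>vertex_pmf\<close> at the incoming edges of \<open>(x, y)\<close>, whatever else is known.
\<close>

locale stochastic_six_vertex = prob_space M
  for M :: "'w measure" and b q :: real and \<eta> :: "'w \<Rightarrow> config" +
  assumes b_bounds: "0 < b" "b < 1"
    and q_bounds: "0 < q" "b * q < 1"
    and occupation_measurable:
      "\<And>e. e \<in> quadrant_edges \<Longrightarrow> (\<lambda>\<omega>. \<eta> \<omega> e) \<in> measurable M (count_space UNIV)"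
    and conservation: "\<And>\<omega>. \<omega> \<in> space M \<Longrightarrow> path_conservation (\<eta> \<omega>)"
    and sampling:
      "\<And>S x y r u. \<lbrakk>finite S; down_closed S; (x, y) \<notin> S; down_closed (insert (x, y) S)\<rbrakk> \<Longrightarrow>
         AE \<omega> in M.
           real_cond_exp M (generated_by M (boundary_edges \<union> out_edges S) (\<lambda>e \<omega>. \<eta> \<omega> e))
             (indicat_real {\<omega> \<in> space M. \<eta> \<omega> (Hor x y) = r \<and> \<eta> \<omega> (Ver x y) = u}) \<omega>
           = pmf (vertex_pmf b q (\<eta> \<omega> (Hor (x - 1) y), \<eta> \<omega> (Ver x (y - 1)))) (r, u)"

definition is_height_function :: "config \<Rightarrow> (nat \<Rightarrow> nat \<Rightarrow> int) \<Rightarrow> bool" where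
  "is_height_function \<eta> h \<longleftrightarrow>
     h 0 0 = 0 \<and>
     (\<forall>x y. 1 \<le> y \<longrightarrow> h x y - h x (y - 1) = (if \<eta> (Hor x y) then 1 else 0)) \<and>
     (\<forall>x y. 1 \<le> x \<longrightarrow> h x y - h (x - 1) y = (if \<eta> (Ver x y) then - 1 else 0))"

lemma is_height_function_explicit:
  assumes "is_height_function \<eta> h"
  shows "h x y = (\<Sum>j=1..y. of_bool (\<eta> (Hor x j))) - (\<Sum>i=1..x. of_bool (\<eta> (Ver i 0)))"
proof -
  have "h x 0 = - (\<Sum>i=1..x. of_bool (\<eta> (Ver i 0)))"
  proof (induction x)
    case 0
    then show ?case using assms by (simp add: is_height_function_def)
  next
    case (Suc x)
    have "h (Suc x) 0 - h x 0 = (if \<eta> (Ver (Suc x) 0) then - 1 else 0)"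
      using assms unfolding is_height_function_def by (metis diff_Suc_1 le_add1 plus_1_eq_Suc)
    then show ?case using Suc by (auto split: if_splits)
  qed
  moreover have "h x y = h x 0 + (\<Sum>j=1..y. of_bool (\<eta> (Hor x j)))"
  proof (induction y)
    case (Suc y)
    have "h x (Suc y) - h x y = (if \<eta> (Hor x (Suc y)) then 1 else 0)"
      using assms unfolding is_height_function_def by (metis diff_Suc_1 le_add1 plus_1_eq_Suc)
    then show ?case using Suc by (auto split: if_splits)
  qed simp
  ultimately show ?thesis by simp
qed

lemma ex1_height_function:
  assumes "path_conservation \<eta>"
  shows "\<exists>!h. is_height_function \<eta> h"
proof (rule ex_ex1I)
  define h :: "nat \<Rightarrow> nat \<Rightarrow> int" where
    "h = (\<lambda>x y. (\<Sum>j=1..y. of_bool (\<eta> (Hor x j))) - (\<Sum>i=1..x. of_bool (\<eta> (Ver i 0))))"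
  have hor: "h x (Suc y) - h x y = of_bool (\<eta> (Hor x (Suc y)))" for x y
    by (simp add: h_def del: sum_of_bool_eq)
  have ver: "h (Suc x) y - h x y = - of_bool (\<eta> (Ver (Suc x) y))" for x y
  proof (induction y)
    case 0
    then show ?case by (simp add: h_def del: sum_of_bool_eq)
  next
    case (Suc y)
    have "of_bool (\<eta> (Hor x (Suc y))) + of_bool (\<eta> (Ver (Suc x) y))
       = (of_bool (\<eta> (Hor (Suc x) (Suc y))) + of_bool (\<eta> (Ver (Suc x) (Suc y))) :: nat)"
      using assms[unfolded path_conservation_def, rule_format, of "Suc x" "Suc y"] by simp
    then have "of_bool (\<eta> (Hor x (Suc y))) + of_bool (\<eta> (Ver (Suc x) y))
       = (of_bool (\<eta> (Hor (Suc x) (Suc y))) + of_bool (\<eta> (Ver (Suc x) (Suc y))) :: int)"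
      by (auto simp: of_bool_def split: if_splits)
    then show ?case using Suc hor[of x y] hor[of "Suc x" y] by linarith
  qed
  have "h x y - h x (y - 1) = (if \<eta> (Hor x y) then 1 else 0)" if "1 \<le> y" for x y
    using hor[of x "y - 1"] that by (simp split: if_splits)
  moreover have "h x y - h (x - 1) y = (if \<eta> (Ver x y) then - 1 else 0)" if "1 \<le> x" for x y
    using ver[of "x - 1" y] that by (simp split: if_splits)
  moreover have "h 0 0 = 0" by (simp add: h_def del: sum_of_bool_eq)
  ultimately show "\<exists>h. is_height_function \<eta> h"
    unfolding is_height_function_def by blast
next
  fix h h' assume "is_height_function \<eta> h" "is_height_function \<eta> h'"
  then show "h = h'" by (intro ext) (simp only: is_height_function_explicit)
qed

definition height_past :: "'w measure \<Rightarrow> ('w \<Rightarrow> nat \<Rightarrow> nat \<Rightarrow> int) \<Rightarrow> nat \<Rightarrow> nat \<Rightarrow> 'w measure" where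
  "height_past M H x y = generated_by M {(u, v). u \<le> x \<or> v \<le> y} (\<lambda>(u, v) \<omega>. H \<omega> u v)"

end

theory Submission
  imports Defs
begin

text \<open>
  The four point relation defines \<open>\<xi>(x+1,y+1)\<close>, so only its conditional moments have to be found. The
  incoming pair of the vertex \<open>(x+1,y+1)\<close> is determined by the heights \<open>H(x,y)\<close>, \<open>H(x+1,y)\<close> and
  \<open>H(x,y+1)\<close>, and \<open>\<xi>(x+1,y+1)\<close> is a function of these three heights and the outgoing pair. Conditionally
  on the past the heights are constants and the outgoing pair has the law \<open>vertex_pmf\<close>, so both
  moments are finite averages, which are computed for the four possible incoming pairs in
  \<open>vertex_moments\<close>.

  The probabilistic content is that the outgoing pair has this law given the whole infinite
  past \<open>{u \<le> x or v \<le> y}\<close>, while the sequential construction gives it only for finite down-closed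
  sets of vertices. Exhausting the past by such sets and a Dynkin system argument
  (\<open>real_cond_exp_generated_by_UN\<close>) yield \<open>sampling_past\<close>, and \<open>cond_exp_past_outgoing\<close> turns it
  into an averaging rule. The heights of the past are functions of the edges of the past
  (\<open>height_measurable_past\<close>), so the \<open>\<sigma>\<close>-algebra of the theorem is coarser than the one of the edges.
  The tower property passes to it without changing the result, because the averages depend only on the
  three heights.
\<close>

section \<open>Generated sigma-algebras and conditional expectations\<close>

lemma space_generated_by [simp]: "space (generated_by M I X) = space M"
  by (simp add: generated_by_def space_measure_of_conv)

lemma sets_generated_by:
  "sets (generated_by M I X) = sigma_sets (space M) {X i -` A \<inter> space M | i A. i \<in> I}"
  unfolding generated_by_def by (rule sets_measure_of) auto

lemma measurable_generated_by:
  assumes "i \<in> I"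
  shows "X i \<in> measurable (generated_by M I X) (count_space UNIV)"
  using assms by (intro measurableI) (auto simp: sets_generated_by intro: sigma_sets.Basic)

lemma subalgebra_generated_by_least:
  assumes "space N = space M"
    and "\<And>i. i \<in> I \<Longrightarrow> X i \<in> measurable N (count_space UNIV)"
  shows "subalgebra N (generated_by M I X)"
proof -
  have "{X i -` A \<inter> space M | i A. i \<in> I} \<subseteq> sets N"
    using assms(2) by (auto simp flip: assms(1) intro: measurable_sets)
  then show ?thesis
    using sets.sigma_sets_subset[of _ N] assms(1) by (simp add: subalgebra_def sets_generated_by)
qed

lemma sets_generated_by_mono:
  assumes "I \<subseteq> J"
  shows "sets (generated_by M I X) \<subseteq> sets (generated_by M J X)"
  unfolding sets_generated_by using assms by (intro sigma_sets_mono') auto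

lemma sets_generated_by_UN:
  fixes J :: "'n \<Rightarrow> 'i set"
  shows "sets (generated_by M (\<Union>n. J n) X) =
    sigma_sets (space M) (\<Union>n. sets (generated_by M (J n) X))"
proof (rule antisym)
  show "sets (generated_by M (\<Union>n. J n) X)
      \<subseteq> sigma_sets (space M) (\<Union>n. sets (generated_by M (J n) X))"
    unfolding sets_generated_by[of M "\<Union>n. J n"]
  proof (rule sigma_sets_mono')
    show "{X i -` A \<inter> space M | i A. i \<in> (\<Union>n. J n)} \<subseteq> (\<Union>n. sets (generated_by M (J n) X))"
      by (fastforce simp: sets_generated_by intro: sigma_sets.Basic)
  qed
  have "(\<Union>n. sets (generated_by M (J n) X)) \<subseteq> sets (generated_by M (\<Union>n. J n) X)"
    by (intro UN_least sets_generated_by_mono) auto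
  then show "sigma_sets (space M) (\<Union>n. sets (generated_by M (J n) X))
      \<subseteq> sets (generated_by M (\<Union>n. J n) X)"
    by (metis sets.sigma_sets_subset space_generated_by)
qed

lemma (in prob_space) sigma_finite_subalgebra_of_subalgebra:
  assumes "subalgebra M F"
  shows "sigma_finite_subalgebra M F"
  by (intro finite_measure_subalgebra_is_sigma_finite finite_measure_subalgebra.intro
      finite_measure_subalgebra_axioms.intro finite_measure_axioms assms)

text \<open>
  If the conditional expectation of \<open>f\<close> given each member of an increasing family of
  \<open>\<sigma>\<close>-algebras is one and the same variable \<open>g\<close>, it is also \<open>g\<close> given their join: the sets over
  which \<open>f\<close> and \<open>g\<close> have the same integral form a Dynkin system, and the union of the family is a
  \<open>\<pi>\<close>-system that generates the join.
\<close>

lemma (in prob_space) real_cond_exp_generated_by_UN: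
  fixes J :: "nat \<Rightarrow> 'i set" and X :: "'i \<Rightarrow> 'a \<Rightarrow> 'c::countable" and f g :: "'a \<Rightarrow> real"
  assumes X: "\<And>i. i \<in> (\<Union>n. J n) \<Longrightarrow> X i \<in> measurable M (count_space UNIV)"
    and J: "incseq J"
    and f: "integrable M f"
    and g: "integrable M g" "g \<in> borel_measurable (generated_by M (\<Union>n. J n) X)"
    and cond: "\<And>n. AE \<omega> in M. real_cond_exp M (generated_by M (J n) X) f \<omega> = g \<omega>"
  shows "AE \<omega> in M. real_cond_exp M (generated_by M (\<Union>n. J n) X) f \<omega> = g \<omega>"
proof -
  let ?F = "\<lambda>n. generated_by M (J n) X" and ?F_join = "generated_by M (\<Union>n. J n) X"
  have sub: "subalgebra M ?F_join"
    by (rule subalgebra_generated_by) (rule X)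
  interpret join: sigma_finite_subalgebra M ?F_join
    by (rule sigma_finite_subalgebra_of_subalgebra[OF sub])
  have sets_M: "A \<in> sets M" if "A \<in> sets ?F_join" for A
    using sub that by (auto simp: subalgebra_def)
  have intgbl: "set_integrable M A h" if "integrable M h" "A \<in> sets M" for h :: "'a \<Rightarrow> real" and A
    using integrable_mult_indicator[OF that(2,1)] by (simp add: set_integrable_def)
  have step: "(\<integral>\<omega>\<in>A. f \<omega> \<partial>M) = (\<integral>\<omega>\<in>A. g \<omega> \<partial>M)" if A: "A \<in> sets (?F n)" for n A
  proof -
    have subn: "subalgebra M (?F n)"
      by (rule subalgebra_generated_by) (use X in blast)
    interpret sigma_finite_subalgebra M "?F n"
      by (rule sigma_finite_subalgebra_of_subalgebra[OF subn])
    have A_M: "A \<in> sets M" using subn A by (auto simp: subalgebra_def)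
    have "(\<integral>\<omega>\<in>A. f \<omega> \<partial>M) = (\<integral>\<omega>\<in>A. real_cond_exp M (?F n) f \<omega> \<partial>M)"
      by (rule real_cond_exp_intA[OF f A])
    also have "\<dots> = (\<integral>\<omega>\<in>A. g \<omega> \<partial>M)"
      unfolding set_lebesgue_integral_def
      using cond[of n] A_M real_cond_exp_int(1)[OF f] g(1)
      by (intro integral_cong_AE) auto
    finally show ?thesis .
  qed
  have whole: "(\<integral>\<omega>\<in>space M. f \<omega> \<partial>M) = (\<integral>\<omega>\<in>space M. g \<omega> \<partial>M)"
    using step[of "space M" 0] sets.top[of "?F 0"] by simp
  have stable: "Int_stable (\<Union>n. sets (?F n))"
  proof (rule Int_stableI)
    fix A B assume "A \<in> (\<Union>n. sets (?F n))" "B \<in> (\<Union>n. sets (?F n))"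
    then obtain m n where mn: "A \<in> sets (?F m)" "B \<in> sets (?F n)" by blast
    have "sets (?F m) \<subseteq> sets (?F (max m n))" "sets (?F n) \<subseteq> sets (?F (max m n))"
      by (intro sets_generated_by_mono incseqD[OF J], simp)+
    with mn have "A \<inter> B \<in> sets (?F (max m n))" by blast
    then show "A \<inter> B \<in> (\<Union>n. sets (?F n))" by blast
  qed
  show ?thesis
  proof (rule join.real_cond_exp_charact[OF _ f g])
    fix A assume "A \<in> sets ?F_join"
    then have A: "A \<in> sigma_sets (space M) (\<Union>n. sets (?F n))"
      by (simp add: sets_generated_by_UN)
    have "(\<Union>n. sets (?F n)) \<subseteq> Pow (space M)"
      using sets.space_closed[of "?F _"] by auto
    from stable this A show "(\<integral>\<omega>\<in>A. f \<omega> \<partial>M) = (\<integral>\<omega>\<in>A. g \<omega> \<partial>M)"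
    proof (induction rule: sigma_sets_induct_disjoint)
      case (compl A)
      have A: "A \<in> sets M" using compl(1) by (intro sets_M) (simp add: sets_generated_by_UN)
      then have "space M = A \<union> (space M - A)" using sets.sets_into_space by blast
      then have split: "(\<integral>\<omega>\<in>space M. h \<omega> \<partial>M) = (\<integral>\<omega>\<in>A. h \<omega> \<partial>M) + (\<integral>\<omega>\<in>space M - A. h \<omega> \<partial>M)"
        if "integrable M h" for h :: "'a \<Rightarrow> real"
        using set_integral_Un[of A "space M - A" M h] intgbl[OF that] A by auto
      show ?case using split[OF f] split[OF g(1)] whole compl(2) by linarith
    next
      case (union A)
      have A: "A i \<in> sets M" for i
        using union(2) by (intro sets_M) (auto simp: sets_generated_by_UN)
      have "(\<integral>\<omega>\<in>(\<Union>i. A i). h \<omega> \<partial>M) = (\<Sum>i. \<integral>\<omega>\<in>A i. h \<omega> \<partial>M)"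
        if "integrable M h" for h :: "'a \<Rightarrow> real"
        using union(1) A by (intro lebesgue_integral_countable_add intgbl[OF that])
          (auto simp: disjoint_family_on_def)
      then show ?case using f g(1) union(3) by simp
    qed (use step in \<open>auto simp: set_lebesgue_integral_def\<close>)
  qed
qed

lemma measurable_Pair_count_space:
  fixes f :: "'a \<Rightarrow> 'b::countable" and g :: "'a \<Rightarrow> 'c::countable"
  assumes "f \<in> measurable M (count_space UNIV)" "g \<in> measurable M (count_space UNIV)"
  shows "(\<lambda>\<omega>. (f \<omega>, g \<omega>)) \<in> measurable M (count_space UNIV)"
  using measurable_Pair[OF assms] by (simp add: pair_measure_countable)

lemma (in finite_measure) integrable_finite_range:
  fixes f :: "'c \<Rightarrow> real"
  assumes X: "X \<in> measurable M (count_space UNIV)" and fin: "finite (X ` space M)"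
  shows "integrable M (\<lambda>\<omega>. f (X \<omega>))"
proof (rule integrable_const_bound)
  show "AE \<omega> in M. norm (f (X \<omega>)) \<le> Max ((\<lambda>s. \<bar>f s\<bar>) ` X ` space M)"
    using fin by (intro AE_I2) auto
  show "(\<lambda>\<omega>. f (X \<omega>)) \<in> borel_measurable M"
    by (rule measurable_compose[OF X]) simp
qed

section \<open>Sampling given an infinite past\<close>

text \<open>
  This set of edges is large enough to determine all heights at \<open>(u, v)\<close> with \<open>u \<le> x\<close> or \<open>v \<le> y\<close>,
  and yet it is exhausted by the boundary and the outgoing edges of finite down-closed sets that
  avoid \<open>(x + 1, y + 1)\<close>, so that the sequential construction applies to it in the limit.
\<close>

definition past_edges :: "nat \<Rightarrow> nat \<Rightarrow> edge set" where
  "past_edges x y = boundary_edges \<union> out_edges {(u, v) \<in> vertices. u \<le> x \<or> v \<le> y}"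

lemma Hor_in_past_edges: "1 \<le> v \<Longrightarrow> u \<le> x \<or> v \<le> y \<Longrightarrow> Hor u v \<in> past_edges x y"
  by (cases "u = 0") (force simp: past_edges_def boundary_edges_def out_edges_def vertices_def)+

lemma Ver_in_past_edges: "1 \<le> u \<Longrightarrow> u \<le> x \<or> v \<le> y \<Longrightarrow> Ver u v \<in> past_edges x y"
  by (cases "v = 0") (force simp: past_edges_def boundary_edges_def out_edges_def vertices_def)+

lemma past_edges_subset: "past_edges x y \<subseteq> quadrant_edges"
  by (auto simp: past_edges_def quadrant_edges_def out_edges_def)

context stochastic_six_vertex
begin

abbreviation past :: "nat \<Rightarrow> nat \<Rightarrow> 'w measure" where
  "past x y \<equiv> generated_by M (past_edges x y) (\<lambda>e \<omega>. \<eta> \<omega> e)"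

lemma subalgebra_past: "subalgebra M (past x y)"
  using past_edges_subset by (intro subalgebra_generated_by occupation_measurable) blast

lemma occupation_measurable_past:
  "e \<in> past_edges x y \<Longrightarrow> (\<lambda>\<omega>. \<eta> \<omega> e) \<in> measurable (past x y) (count_space UNIV)"
  using measurable_generated_by[of e "past_edges x y" "\<lambda>e \<omega>. \<eta> \<omega> e"] by simp

text \<open>
  The vertices of the rectangle \<open>{1..n + x + 1} \<times> {1..n + y + 1}\<close> that lie in a column up to \<open>x\<close> or in a
  row up to \<open>y\<close> form a finite down-closed set, after which \<open>(x + 1, y + 1)\<close> may come next. The
  prescribed law does not depend on \<open>n\<close>, so it survives the passage to the infinite past.
\<close>

lemma sampling_past:
  "AE \<omega> in M.
     real_cond_exp M (past x y)
       (indicat_real {\<omega> \<in> space M. \<eta> \<omega> (Hor (x + 1) (y + 1)) = r \<and> \<eta> \<omega> (Ver (x + 1) (y + 1)) = u}) \<omega>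
     = pmf (vertex_pmf b q (\<eta> \<omega> (Hor x (y + 1)), \<eta> \<omega> (Ver (x + 1) y))) (r, u)"
proof -
  define S where "S n = {(u, v). 1 \<le> u \<and> u \<le> n + x + 1 \<and> 1 \<le> v \<and> v \<le> n + y + 1 \<and> (u \<le> x \<or> v \<le> y)}"
    for n :: nat
  define J where "J n = boundary_edges \<union> out_edges (S n)" for n
  have fin: "finite (S n)" for n
    by (rule finite_subset[of _ "{..n + x + 1} \<times> {..n + y + 1}"]) (auto simp: S_def)
  have closed: "down_closed (S n)" "down_closed (insert (x + 1, y + 1) (S n))"
    and new: "(x + 1, y + 1) \<notin> S n" for n
    by (auto simp: S_def down_closed_def vertices_def)
  have inc: "incseq J"
    by (rule incseq_SucI) (auto simp: J_def S_def out_edges_def)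
  have "(\<Union>n. S n) = {(u, v) \<in> vertices. u \<le> x \<or> v \<le> y}"
  proof (intro equalityI subsetI)
    fix p assume "p \<in> {(u, v) \<in> vertices. u \<le> x \<or> v \<le> y}"
    then have "p \<in> S (fst p + snd p)" by (auto simp: S_def vertices_def)
    then show "p \<in> (\<Union>n. S n)" by blast
  qed (auto simp: S_def vertices_def)
  then have J_UN: "(\<Union>n. J n) = past_edges x y"
    unfolding past_edges_def J_def out_edges_def by blast
  let ?out = "{\<omega> \<in> space M. \<eta> \<omega> (Hor (x + 1) (y + 1)) = r \<and> \<eta> \<omega> (Ver (x + 1) (y + 1)) = u}"
  let ?p = "\<lambda>i. pmf (vertex_pmf b q i) (r, u)"
  let ?in = "\<lambda>\<omega>. (\<eta> \<omega> (Hor x (y + 1)), \<eta> \<omega> (Ver (x + 1) y))"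
  have out_edge: "Hor (x + 1) (y + 1) \<in> quadrant_edges" "Ver (x + 1) (y + 1) \<in> quadrant_edges"
    by (auto simp: quadrant_edges_def out_edges_def vertices_def)
  have "?out \<in> sets M"
    using occupation_measurable[OF out_edge(1)] occupation_measurable[OF out_edge(2)]
    by measurable
  then have int_out: "integrable M (indicat_real ?out)"
    by (rule integrable_real_indicator) (simp add: less_top[symmetric])
  have in_past: "?in \<in> measurable (past x y) (count_space UNIV)"
    by (intro measurable_Pair_count_space occupation_measurable_past
        Hor_in_past_edges Ver_in_past_edges) auto
  have int_p: "integrable M (\<lambda>\<omega>. ?p (?in \<omega>))"
    by (rule integrable_finite_range[OF measurable_from_subalg[OF subalgebra_past in_past]]) simp
  have "AE \<omega> in M. real_cond_exp M (generated_by M (\<Union>n. J n) (\<lambda>e \<omega>. \<eta> \<omega> e)) (indicat_real ?out) \<omega>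
      = ?p (?in \<omega>)"
  proof (rule real_cond_exp_generated_by_UN[OF _ inc int_out int_p])
    show "(\<lambda>\<omega>. \<eta> \<omega> e) \<in> measurable M (count_space UNIV)" if "e \<in> (\<Union>n. J n)" for e
      using that past_edges_subset by (intro occupation_measurable) (auto simp: J_UN)
    show "(\<lambda>\<omega>. ?p (?in \<omega>)) \<in> borel_measurable (generated_by M (\<Union>n. J n) (\<lambda>e \<omega>. \<eta> \<omega> e))"
      unfolding J_UN by (rule measurable_compose[OF in_past]) simp
    show "AE \<omega> in M. real_cond_exp M (generated_by M (J n) (\<lambda>e \<omega>. \<eta> \<omega> e)) (indicat_real ?out) \<omega>
        = ?p (?in \<omega>)" for n
      using sampling[OF fin closed(1) new closed(2), of n r u] by (simp add: J_def)
  qed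
  then show ?thesis by (simp add: J_UN)
qed

text \<open>
  The substitution rule for conditional expectations: a variable \<open>X\<close> known from the past may be
  treated as a constant, and only the outgoing pair is averaged. Decomposing over the four values of
  the pair reduces this to taking known factors out of the conditional expectation.
\<close>

lemma cond_exp_past_outgoing:
  fixes X :: "'w \<Rightarrow> 's" and f :: "'s \<Rightarrow> bool \<times> bool \<Rightarrow> real"
  assumes X: "X \<in> measurable (past x y) (count_space UNIV)" and fin: "finite (X ` space M)"
  shows "integrable M (\<lambda>\<omega>. f (X \<omega>) (\<eta> \<omega> (Hor (x + 1) (y + 1)), \<eta> \<omega> (Ver (x + 1) (y + 1))))"
    and "AE \<omega> in M.
      real_cond_exp M (past x y)
        (\<lambda>\<omega>. f (X \<omega>) (\<eta> \<omega> (Hor (x + 1) (y + 1)), \<eta> \<omega> (Ver (x + 1) (y + 1)))) \<omega>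
      = measure_pmf.expectation (vertex_pmf b q (\<eta> \<omega> (Hor x (y + 1)), \<eta> \<omega> (Ver (x + 1) y))) (f (X \<omega>))"
proof -
  interpret past: sigma_finite_subalgebra M "past x y"
    by (rule sigma_finite_subalgebra_of_subalgebra[OF subalgebra_past])
  let ?out = "\<lambda>\<omega>. (\<eta> \<omega> (Hor (x + 1) (y + 1)), \<eta> \<omega> (Ver (x + 1) (y + 1)))"
  let ?in = "\<lambda>\<omega>. (\<eta> \<omega> (Hor x (y + 1)), \<eta> \<omega> (Ver (x + 1) y))"
  define E where "E p = {\<omega> \<in> space M. \<eta> \<omega> (Hor (x + 1) (y + 1)) = fst p \<and> \<eta> \<omega> (Ver (x + 1) (y + 1)) = snd p}"
    for p
  have out_edge: "Hor (x + 1) (y + 1) \<in> quadrant_edges" "Ver (x + 1) (y + 1) \<in> quadrant_edges"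
    by (auto simp: quadrant_edges_def out_edges_def vertices_def)
  have E: "E p \<in> sets M" for p
    using occupation_measurable[OF out_edge(1)] occupation_measurable[OF out_edge(2)]
    unfolding E_def by measurable
  have known: "(\<lambda>\<omega>. f (X \<omega>) p) \<in> borel_measurable (past x y)" for p
    by (rule measurable_compose[OF X]) simp
  have "integrable M (\<lambda>\<omega>. f (X \<omega>) p)" for p
    by (rule integrable_finite_range[OF measurable_from_subalg[OF subalgebra_past X] fin])
  from integrable_mult_indicator[OF E this]
  have int: "integrable M (\<lambda>\<omega>. f (X \<omega>) p * indicat_real (E p) \<omega>)" for p
    by (simp add: mult.commute)
  have split: "(\<Sum>p\<in>UNIV. f (X \<omega>) p * indicat_real (E p) \<omega>) = f (X \<omega>) (?out \<omega>)"
    if "\<omega> \<in> space M" for \<omega>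
  proof -
    have "(\<Sum>p\<in>UNIV. f (X \<omega>) p * indicat_real (E p) \<omega>)
        = (\<Sum>p\<in>UNIV. if p = ?out \<omega> then f (X \<omega>) p else 0)"
      using that by (intro sum.cong) (auto simp: E_def indicator_def)
    then show ?thesis by simp
  qed
  have int_sum: "integrable M (\<lambda>\<omega>. \<Sum>p\<in>UNIV. f (X \<omega>) p * indicat_real (E p) \<omega>)"
    by (rule Bochner_Integration.integrable_sum[OF int])
  have "integrable M (\<lambda>\<omega>. \<Sum>p\<in>UNIV. f (X \<omega>) p * indicat_real (E p) \<omega>)
      \<longleftrightarrow> integrable M (\<lambda>\<omega>. f (X \<omega>) (?out \<omega>))"
    by (intro Bochner_Integration.integrable_cong refl split)
  then show int_f: "integrable M (\<lambda>\<omega>. f (X \<omega>) (?out \<omega>))"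
    using int_sum by blast
  have average: "measure_pmf.expectation P g = (\<Sum>p\<in>UNIV. g p * pmf P p)"
    for P :: "(bool \<times> bool) pmf" and g :: "bool \<times> bool \<Rightarrow> real"
    by (rule integral_measure_pmf_real) auto
  have "AE \<omega> in M. real_cond_exp M (past x y) (\<lambda>\<omega>. f (X \<omega>) (?out \<omega>)) \<omega>
      = real_cond_exp M (past x y) (\<lambda>\<omega>. \<Sum>p\<in>UNIV. f (X \<omega>) p * indicat_real (E p) \<omega>) \<omega>"
    by (intro past.real_cond_exp_cong AE_I2 split[symmetric] borel_measurable_integrable int_sum int_f)
  moreover have "AE \<omega> in M. real_cond_exp M (past x y)
      (\<lambda>\<omega>. \<Sum>p\<in>UNIV. f (X \<omega>) p * indicat_real (E p) \<omega>) \<omega>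
      = (\<Sum>p\<in>UNIV. real_cond_exp M (past x y) (\<lambda>\<omega>. f (X \<omega>) p * indicat_real (E p) \<omega>) \<omega>)"
    by (rule past.real_cond_exp_sum[OF int])
  moreover have "AE \<omega> in M. \<forall>p. real_cond_exp M (past x y) (\<lambda>\<omega>. f (X \<omega>) p * indicat_real (E p) \<omega>) \<omega>
      = f (X \<omega>) p * real_cond_exp M (past x y) (indicat_real (E p)) \<omega>"
    using E int known by (intro AE_all_countable[THEN iffD2] allI past.real_cond_exp_mult) auto
  moreover have "AE \<omega> in M. \<forall>p. real_cond_exp M (past x y) (indicat_real (E p)) \<omega>
      = pmf (vertex_pmf b q (?in \<omega>)) p"
  proof (intro AE_all_countable[THEN iffD2] allI)
    show "AE \<omega> in M. real_cond_exp M (past x y) (indicat_real (E p)) \<omega>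
        = pmf (vertex_pmf b q (?in \<omega>)) p" for p
      using sampling_past[of x y "fst p" "snd p"] by (simp add: E_def)
  qed
  ultimately show "AE \<omega> in M. real_cond_exp M (past x y) (\<lambda>\<omega>. f (X \<omega>) (?out \<omega>)) \<omega>
      = measure_pmf.expectation (vertex_pmf b q (?in \<omega>)) (f (X \<omega>))"
    by eventually_elim (simp only: average)
qed

end

section \<open>The height function around a vertex\<close>

lemma height_function_Suc:
  assumes "is_height_function \<eta> h"
  shows "h x (Suc y) = h x y + of_bool (\<eta> (Hor x (Suc y)))"
    and "h (Suc x) y = h x y - of_bool (\<eta> (Ver (Suc x) y))"
proof -
  have "h x (Suc y) - h x y = (if \<eta> (Hor x (Suc y)) then 1 else 0)"
    "h (Suc x) y - h x y = (if \<eta> (Ver (Suc x) y) then - 1 else 0)"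
    using assms unfolding is_height_function_def by (metis diff_Suc_1 le_add1 plus_1_eq_Suc)+
  then show "h x (Suc y) = h x y + of_bool (\<eta> (Hor x (Suc y)))"
    "h (Suc x) y = h x y - of_bool (\<eta> (Ver (Suc x) y))"
    by (auto split: if_splits)
qed

lemma height_function_bounds:
  assumes "is_height_function \<eta> h"
  shows "h x y \<in> {- int x..int y}"
proof -
  have "(\<Sum>j=1..y. of_bool (\<eta> (Hor x j)) :: int) \<le> (\<Sum>j=1..y. 1)"
    "(\<Sum>i=1..x. of_bool (\<eta> (Ver i 0)) :: int) \<le> (\<Sum>i=1..x. 1)"
    by (auto intro!: sum_mono simp del: sum_of_bool_eq sum_constant)
  moreover have "(\<Sum>j=1..y. of_bool (\<eta> (Hor x j)) :: int) \<ge> 0"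
    "(\<Sum>i=1..x. of_bool (\<eta> (Ver i 0)) :: int) \<ge> 0"
    by (auto intro!: sum_nonneg simp del: sum_of_bool_eq)
  ultimately show ?thesis
    unfolding is_height_function_explicit[OF assms, of x y] atLeastAtMost_iff
    by (simp del: sum_of_bool_eq)
qed

text \<open>
  The height at \<open>(u, v)\<close> counts the paths crossing the lattice walk that goes along the bottom
  boundary to \<open>(u, 0)\<close> and then up to \<open>(u, v)\<close>; this walk stays in the past.
\<close>

lemma (in stochastic_six_vertex) height_measurable_past:
  assumes H: "\<And>\<omega>. \<omega> \<in> space M \<Longrightarrow> is_height_function (\<eta> \<omega>) (H \<omega>)"
    and uv: "u \<le> x \<or> v \<le> y"
  shows "(\<lambda>\<omega>. H \<omega> u v) \<in> measurable (past x y) (count_space UNIV)"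
proof -
  have edge: "(\<lambda>\<omega>. of_bool (\<eta> \<omega> e) :: int) \<in> measurable (past x y) (count_space UNIV)"
    if "e \<in> past_edges x y" for e
    by (rule measurable_compose[OF occupation_measurable_past[OF that]]) simp
  have add: "(\<lambda>\<omega>. f \<omega> + g \<omega>) \<in> measurable (past x y) (count_space UNIV)"
    and diff: "(\<lambda>\<omega>. f \<omega> - g \<omega>) \<in> measurable (past x y) (count_space UNIV)"
    if "f \<in> measurable (past x y) (count_space UNIV)" "g \<in> measurable (past x y) (count_space UNIV)"
    for f g :: "'w \<Rightarrow> int"
    using measurable_compose[OF measurable_Pair_count_space[OF that], of "\<lambda>p. fst p + snd p"]
      measurable_compose[OF measurable_Pair_count_space[OF that], of "\<lambda>p. fst p - snd p"]
    by auto
  have bottom: "(\<lambda>\<omega>. H \<omega> u 0) \<in> measurable (past x y) (count_space UNIV)" for u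
  proof (induction u)
    case 0
    have "(\<lambda>\<omega>. H \<omega> 0 0) \<in> measurable (past x y) (count_space UNIV)
        \<longleftrightarrow> (\<lambda>\<omega>. 0 :: int) \<in> measurable (past x y) (count_space UNIV)"
      using H by (intro measurable_cong) (simp add: is_height_function_def)
    then show ?case by simp
  next
    case (Suc u)
    have "(\<lambda>\<omega>. H \<omega> (Suc u) 0) \<in> measurable (past x y) (count_space UNIV)
        \<longleftrightarrow> (\<lambda>\<omega>. H \<omega> u 0 - of_bool (\<eta> \<omega> (Ver (Suc u) 0))) \<in> measurable (past x y) (count_space UNIV)"
      using H by (intro measurable_cong) (simp add: height_function_Suc(2))
    then show ?case using diff[OF Suc edge] by (simp add: Ver_in_past_edges)
  qed
  show ?thesis
    using uv
  proof (induction v)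
    case (Suc v)
    have "(\<lambda>\<omega>. H \<omega> u (Suc v)) \<in> measurable (past x y) (count_space UNIV)
        \<longleftrightarrow> (\<lambda>\<omega>. H \<omega> u v + of_bool (\<eta> \<omega> (Hor u (Suc v)))) \<in> measurable (past x y) (count_space UNIV)"
      using H by (intro measurable_cong) (simp add: height_function_Suc(1))
    moreover have "Hor u (Suc v) \<in> past_edges x y"
      using Suc.prems by (intro Hor_in_past_edges) auto
    ultimately show ?case using Suc add[OF _ edge] by auto
  qed (rule bottom)
qed

section \<open>One-vertex moments and the four point relation\<close>

text \<open>
  The left-hand side of the four point relation, in terms of the three heights
  \<open>(H(x,y), H(x+1,y), H(x,y+1))\<close> and the occupation of the outgoing pair; an upward path lowers the
  fourth height by one compared with \<open>H(x,y+1)\<close>.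
\<close>

definition four_point_noise ::
    "real \<Rightarrow> real \<Rightarrow> int \<times> int \<times> int \<Rightarrow> bool \<times> bool \<Rightarrow> real" where
  "four_point_noise b q = (\<lambda>(h, hx, hy) (r, u).
     q powi (hy - of_bool u) - b * q powi hy - b * q * q powi hx + (b + b * q - 1) * q powi h)"

definition four_point_variance :: "real \<Rightarrow> real \<Rightarrow> int \<times> int \<times> int \<Rightarrow> real" where
  "four_point_variance b q = (\<lambda>(h, hx, hy).
     (q * b * (1 - b) + b * (1 - q * b)) * (q powi hx - q powi h) * (q powi hy - q powi h)
       + b * (1 - q * b) * (1 - q) * q powi h * (q powi hx - q powi h)
       - b * (1 - b) * (1 - q) * q powi h * (q powi hy - q powi h))"

text \<open>
  The coefficients of the four point relation are those for which the noise is centred at every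
  type of vertex. With no or two incoming paths the outgoing pair is forced and the noise is \<open>0\<close>.
  With one incoming path the noise takes two values, and its second moment is the term of the
  variance in \<open>\<Delta>x\<close> for a path from below and in \<open>\<Delta>y\<close> for a path from the left, the other increment
  being \<open>0\<close>. The coefficient of \<open>\<Delta>x * \<Delta>y\<close> is then the one that makes the variance vanish for two
  incoming paths.
\<close>

lemma vertex_moments:
  fixes b q :: real and h :: int and l d :: bool
  assumes b: "0 < b" "b < 1" and q: "0 < q" "b * q < 1"
  defines "s \<equiv> (h, h - of_bool d, h + of_bool l)"
  shows "measure_pmf.expectation (vertex_pmf b q (l, d)) (four_point_noise b q s) = 0"
    and "measure_pmf.expectation (vertex_pmf b q (l, d)) (\<lambda>p. (four_point_noise b q s p)\<^sup>2)
      = four_point_variance b q s"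
proof -
  have b': "0 \<le> b" "b \<le> 1" and bq: "0 \<le> b * q" "b * q \<le> 1" and q': "q \<noteq> 0"
    using b q by auto
  \<comment> \<open>All powers of \<open>q\<close> that occur are nonnegative powers of \<open>q\<close> times the lowest one, so that after
    the case split both sides are polynomials in \<open>b\<close>, \<open>q\<close> and \<open>Q\<close>.\<close>
  define Q where "Q = q powi (h - 1)"
  have Q: "q powi (h - 1) = Q" "q powi h = q * Q" "q powi (1 + h) = q * q * Q"
    using q' by (auto simp: Q_def power_int_diff power_int_add)
  show "measure_pmf.expectation (vertex_pmf b q (l, d)) (four_point_noise b q s) = 0"
    by (cases l; cases d)
      (simp_all add: s_def vertex_pmf_def four_point_noise_def add.commute[of h 1] Q b' bq algebra_simps)
  show "measure_pmf.expectation (vertex_pmf b q (l, d)) (\<lambda>p. (four_point_noise b q s p)\<^sup>2)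
      = four_point_variance b q s"
    by (cases l; cases d)
      (simp_all add: s_def vertex_pmf_def four_point_noise_def four_point_variance_def
        add.commute[of h 1] Q b' bq power2_eq_square algebra_simps)
qed

theorem theorem3p1:
  fixes M :: "'w measure" and b q :: real
    and \<eta> :: "'w \<Rightarrow> config" and H :: "'w \<Rightarrow> nat \<Rightarrow> nat \<Rightarrow> int"
  assumes "stochastic_six_vertex M b q \<eta>"
    and "\<And>\<omega>. \<omega> \<in> space M \<Longrightarrow> is_height_function (\<eta> \<omega>) (H \<omega>)"
  shows "\<exists>\<xi> :: nat \<Rightarrow> nat \<Rightarrow> 'w \<Rightarrow> real. \<forall>x y.
    (\<forall>\<omega>\<in>space M.
       q powi H \<omega> (x + 1) (y + 1) - b * q powi H \<omega> x (y + 1) - b * q * q powi H \<omega> (x + 1) y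
         + (b + b * q - 1) * q powi H \<omega> x y = \<xi> (x + 1) (y + 1) \<omega>) \<and>
    (AE \<omega> in M. real_cond_exp M (height_past M H x y) (\<xi> (x + 1) (y + 1)) \<omega> = 0) \<and>
    (AE \<omega> in M.
       let \<Delta>x = q powi H \<omega> (x + 1) y - q powi H \<omega> x y;
           \<Delta>y = q powi H \<omega> x (y + 1) - q powi H \<omega> x y
       in real_cond_exp M (height_past M H x y) (\<lambda>\<omega>'. (\<xi> (x + 1) (y + 1) \<omega>')\<^sup>2) \<omega>
          = (q * b * (1 - b) + b * (1 - q * b)) * \<Delta>x * \<Delta>y
            + b * (1 - q * b) * (1 - q) * q powi H \<omega> x y * \<Delta>x
            - b * (1 - b) * (1 - q) * q powi H \<omega> x y * \<Delta>y)"
proof -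
  interpret stochastic_six_vertex M b q \<eta> by (rule assms(1))
  note H = assms(2)
  define heights where "heights x y \<omega> = (H \<omega> x y, H \<omega> (x + 1) y, H \<omega> x (y + 1))" for x y \<omega>
  define out where "out x y \<omega> = (\<eta> \<omega> (Hor (x + 1) (y + 1)), \<eta> \<omega> (Ver (x + 1) (y + 1)))" for x y \<omega>
  define \<xi> where "\<xi> i j \<omega> = four_point_noise b q (heights (i - 1) (j - 1) \<omega>) (out (i - 1) (j - 1) \<omega>)"
    for i j \<omega>
  \<comment> \<open>The heights in \<open>heights x y\<close> differ by the occupation of the incoming edges, so the average over
    the outgoing pair is a function of them alone. It is thus measurable for the height past, and the
    tower property replaces the past of all edges by the coarser past of heights.\<close>
  have cond: "AE \<omega> in M. real_cond_exp M (height_past M H x y)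
        (\<lambda>\<omega>. f (heights x y \<omega>) (out x y \<omega>)) \<omega> = g (heights x y \<omega>)"
    if moment: "\<And>h l d. measure_pmf.expectation (vertex_pmf b q (l, d))
        (f (h, h - of_bool d, h + of_bool l)) = g (h, h - of_bool d, h + of_bool l)"
    for f :: "int \<times> int \<times> int \<Rightarrow> bool \<times> bool \<Rightarrow> real" and g x y
  proof -
    have height: "(\<lambda>\<omega>. H \<omega> u v) \<in> measurable (height_past M H x y) (count_space UNIV)"
      if "u \<le> x \<or> v \<le> y" for u v
      using measurable_generated_by[of "(u, v)" "{(u, v). u \<le> x \<or> v \<le> y}" "\<lambda>(u, v) \<omega>. H \<omega> u v" M] that
      by (simp add: height_past_def)
    have heights: "heights x y \<in> measurable (height_past M H x y) (count_space UNIV)"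
      unfolding heights_def by (intro measurable_Pair_count_space height) auto
    have sub: "subalgebra (past x y) (height_past M H x y)"
      unfolding height_past_def
      by (rule subalgebra_generated_by_least) (auto intro: height_measurable_past[OF H])
    then have sub_M: "subalgebra M (height_past M H x y)"
      using subalgebra_past[of x y] by (auto simp: subalgebra_def)
    interpret sigma_finite_subalgebra M "height_past M H x y"
      by (rule sigma_finite_subalgebra_of_subalgebra[OF sub_M])
    have heights_past: "heights x y \<in> measurable (past x y) (count_space UNIV)"
      by (rule measurable_from_subalg[OF sub heights])
    have fin: "finite (heights x y ` space M)"
    proof (rule finite_subset)
      show "heights x y ` space M \<subseteq> {- int x..int y} \<times> {- int (x + 1)..int y} \<times> {- int x..int (y + 1)}"
        using height_function_bounds[OF H] unfolding heights_def by blast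
    qed simp
    note past_exp = cond_exp_past_outgoing[OF heights_past fin, where f = f, folded out_def]
    have int_g: "integrable M (\<lambda>\<omega>. g (heights x y \<omega>))"
      by (rule integrable_finite_range[OF measurable_from_subalg[OF sub_M heights] fin])
    have "AE \<omega> in M. real_cond_exp M (past x y) (\<lambda>\<omega>. f (heights x y \<omega>) (out x y \<omega>)) \<omega>
        = g (heights x y \<omega>)"
      using past_exp(2) AE_space
    proof eventually_elim
      case (elim \<omega>)
      then show ?case
        using moment[of "\<eta> \<omega> (Hor x (y + 1))" "\<eta> \<omega> (Ver (x + 1) y)" "H \<omega> x y"]
        by (simp add: heights_def height_function_Suc[OF H])
    qed
    moreover have "real_cond_exp M (past x y) (\<lambda>\<omega>. f (heights x y \<omega>) (out x y \<omega>)) \<in> borel_measurable M"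
      by (rule borel_measurable_cond_exp2)
    ultimately have "AE \<omega> in M. real_cond_exp M (height_past M H x y)
          (real_cond_exp M (past x y) (\<lambda>\<omega>. f (heights x y \<omega>) (out x y \<omega>))) \<omega>
        = real_cond_exp M (height_past M H x y) (\<lambda>\<omega>. g (heights x y \<omega>)) \<omega>"
      using int_g by (intro real_cond_exp_cong) auto
    moreover have "AE \<omega> in M. real_cond_exp M (height_past M H x y)
          (real_cond_exp M (past x y) (\<lambda>\<omega>. f (heights x y \<omega>) (out x y \<omega>))) \<omega>
        = real_cond_exp M (height_past M H x y) (\<lambda>\<omega>. f (heights x y \<omega>) (out x y \<omega>)) \<omega>"
      by (rule real_cond_exp_nested_subalg[OF subalgebra_past sub past_exp(1)])
    moreover have "AE \<omega> in M. real_cond_exp M (height_past M H x y) (\<lambda>\<omega>. g (heights x y \<omega>)) \<omega>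
        = g (heights x y \<omega>)"
      by (rule real_cond_exp_F_meas[OF int_g]) (rule measurable_compose[OF heights], simp)
    ultimately show ?thesis by eventually_elim simp
  qed
  note moments = vertex_moments[OF b_bounds q_bounds]
  show ?thesis
  proof (intro exI[of _ \<xi>] allI conjI ballI)
    fix x y \<omega> assume "\<omega> \<in> space M"
    then show "q powi H \<omega> (x + 1) (y + 1) - b * q powi H \<omega> x (y + 1) - b * q * q powi H \<omega> (x + 1) y
        + (b + b * q - 1) * q powi H \<omega> x y = \<xi> (x + 1) (y + 1) \<omega>"
      using height_function_Suc(2)[OF H, of \<omega> x "Suc y"]
      by (simp add: \<xi>_def heights_def out_def four_point_noise_def)
  next
    fix x y
    show "AE \<omega> in M. real_cond_exp M (height_past M H x y) (\<xi> (x + 1) (y + 1)) \<omega> = 0"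
      using cond[of "four_point_noise b q" "\<lambda>_. 0" x y, OF moments(1)] by (simp add: \<xi>_def[abs_def])
  next
    fix x y
    show "AE \<omega> in M.
       let \<Delta>x = q powi H \<omega> (x + 1) y - q powi H \<omega> x y;
           \<Delta>y = q powi H \<omega> x (y + 1) - q powi H \<omega> x y
       in real_cond_exp M (height_past M H x y) (\<lambda>\<omega>'. (\<xi> (x + 1) (y + 1) \<omega>')\<^sup>2) \<omega>
          = (q * b * (1 - b) + b * (1 - q * b)) * \<Delta>x * \<Delta>y
            + b * (1 - q * b) * (1 - q) * q powi H \<omega> x y * \<Delta>x
            - b * (1 - b) * (1 - q) * q powi H \<omega> x y * \<Delta>y"
      using cond[of "\<lambda>s p. (four_point_noise b q s p)\<^sup>2" "four_point_variance b q" x y, OF moments(2)]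
      by (simp add: \<xi>_def heights_def four_point_variance_def Let_def)
  qed
qed

end
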